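(* Let $n\ge 1$ and $r\ge 1$ be integers. Let $D_{r,n}$ be the number of descents of the permutation obtained after $r$ iterated random-to-top shuffles of an $n$-card deck, starting from the identity. Then there exist, on a common probability space, a random variable $K_{r,n}$ distributed as the number of occupied boxes when $r$ balls are thrown independently and uniformly at random into $n$ boxes, i.i.d. continuous uniform$(0,1)$ random variables $U_1,\dots,U_n$ independent of $K_{r,n}$, and a random variable $E_{r,n}$ with $|E_{r,n}|\le 1$, such that $D_{r,n}$ is equal in distribution to $$E_{r,n}+\sum_{i=1}^{K_{r,n}-1}\mathbf{1}(U_i>U_{i+1}).$$
   Context: A deck of $n$ cards labelled $1,\dots,n$ in some order is encoded by the permutation $\sigma$ of $[n]=\{1,\dots,n\}$ where $\sigma(i)$ is the card in position $i$ (position $1$ is the top). A random-to-top shuffle selects one of the $n$ cards uniformly at random (the top card may be selected) and moves it to the top, keeping the relative order of the other cards. Iterated random-to-top shuffles start from the deck in order $12\cdots n$ and perform the selections independently. A descent of $\sigma$ is an index $i\in\{1,\dots,n-1\}$ with $\sigma(i)>\sigma(i+1)$. $\mathbf{1}(A)$ is the indicator of the event $A$; empty sums are $0$. *)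

theory Defs
  imports "HOL-Probability.Probability" "HOL-Combinatorics.Permutations"
begin

text \<open>A deck is a permutation \<open>\<sigma>\<close> of \<open>{1..n}\<close>, where \<open>\<sigma> i\<close> is the card in position \<open>i\<close> and
  position 1 is the top; \<open>\<sigma>\<close> is the identity outside \<open>{1..n}\<close>, as required by \<open>permutes\<close>.
  Moving card \<open>c\<close>, which sits in position \<open>inv \<sigma> c\<close>, to the top pushes the cards formerly above
  it down by one position and leaves the cards below it in place.\<close>

definition move_to_top :: "nat \<Rightarrow> (nat \<Rightarrow> nat) \<Rightarrow> nat \<Rightarrow> nat" where
  "move_to_top c \<sigma> = (\<lambda>i. if i = 1 then c else if 1 < i \<and> i \<le> inv \<sigma> c then \<sigma> (i - 1) else \<sigma> i)"

definition random_to_top :: "nat \<Rightarrow> (nat \<Rightarrow> nat) \<Rightarrow> (nat \<Rightarrow> nat) pmf" where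
  "random_to_top n \<sigma> = map_pmf (\<lambda>c. move_to_top c \<sigma>) (pmf_of_set {1..n})"

primrec iterated_random_to_top :: "nat \<Rightarrow> nat \<Rightarrow> (nat \<Rightarrow> nat) pmf" where
  "iterated_random_to_top n 0 = return_pmf id"
| "iterated_random_to_top n (Suc r) = bind_pmf (iterated_random_to_top n r) (random_to_top n)"

definition descents :: "nat \<Rightarrow> (nat \<Rightarrow> nat) \<Rightarrow> nat" where
  "descents n \<sigma> = card {i \<in> {1..<n}. \<sigma> i > \<sigma> (i + 1)}"

text \<open>The law of the number of occupied boxes when the balls \<open>1, \<dots>, r\<close> are thrown independently
  and uniformly into the boxes \<open>1, \<dots>, n\<close>; ball \<open>j\<close> lands in box \<open>f j\<close>.  The second argument of
  \<open>Pi_pmf\<close> is only the value of \<open>f\<close> outside \<open>{1..r}\<close>.\<close>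

definition occupied_boxes :: "nat \<Rightarrow> nat \<Rightarrow> nat pmf" where
  "occupied_boxes r n =
     map_pmf (\<lambda>f. card {b \<in> {1..n}. \<exists>j\<in>{1..r}. f j = b})
       (Pi_pmf {1..r} 0 (\<lambda>_. pmf_of_set {1..n}))"

text \<open>Consistency checks: \<open>move_to_top\<close> yields a deck with \<open>c\<close> on top in which all other cards
  keep their relative order.\<close>

lemma move_to_top_top: "move_to_top c \<sigma> 1 = c"
  by (simp add: move_to_top_def)

lemma
  assumes "\<sigma> permutes {1..n}" "c \<in> {1..n}"
  shows move_to_top_permutes: "move_to_top c \<sigma> permutes {1..n}"
    and inv_move_to_top: "a \<in> {1..n} - {c} \<Longrightarrow>
      inv (move_to_top c \<sigma>) a = (if inv \<sigma> a < inv \<sigma> c then inv \<sigma> a + 1 else inv \<sigma> a)"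
    and move_to_top_order: "\<lbrakk>a \<in> {1..n} - {c}; b \<in> {1..n} - {c}\<rbrakk> \<Longrightarrow>
      inv (move_to_top c \<sigma>) a < inv (move_to_top c \<sigma>) b \<longleftrightarrow> inv \<sigma> a < inv \<sigma> b"
proof -
  have mem: "inv \<sigma> x \<in> {1..n}" if "x \<in> {1..n}" for x
    using permutes_in_image[OF permutes_inv[OF assms(1)]] that by blast
  define p where "p = inv \<sigma> c"
  have p: "p \<in> {1..n}" "\<sigma> p = c"
    using mem[OF assms(2)] permutes_inverses(1)[OF assms(1)] by (simp_all add: p_def)
  have inj: "\<sigma> x = \<sigma> y \<longleftrightarrow> x = y" for x y
    using permutes_inj[OF assms(1)] by (auto dest: injD)
  let ?t = "move_to_top c \<sigma>"
  define g where "g i = (if i = 1 then p else if 1 < i \<and> i \<le> p then i - 1 else i)" for i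
  have t: "?t i = \<sigma> (g i)" for i
    by (simp add: move_to_top_def g_def p(2) flip: p_def)
  have g: "x = y" if "x \<in> {1..n}" "y \<in> {1..n}" "g x = g y" for x y
    using that unfolding g_def by (simp split: if_splits)
  have inj_t: "inj_on ?t {1..n}"
  proof (rule inj_onI)
    fix x y assume "x \<in> {1..n}" "y \<in> {1..n}" "?t x = ?t y"
    then show "x = y" using g t inj by metis
  qed
  have "?t i \<in> {1..n}" if "i \<in> {1..n}" for i
  proof -
    have "\<sigma> i \<in> {1..n}" using permutes_in_image[OF assms(1)] that by blast
    moreover have "\<sigma> (i - 1) \<in> {1..n}" if "1 < i"
    proof -
      have "i - 1 \<in> {1..n}" using \<open>i \<in> {1..n}\<close> that by auto
      then show ?thesis using permutes_in_image[OF assms(1)] by blast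
    qed
    ultimately show ?thesis
      using assms(2) by (auto simp: move_to_top_def)
  qed
  then have "?t ` {1..n} \<subseteq> {1..n}" by blast
  then have "bij_betw ?t {1..n} {1..n}"
    using inj_t by (simp add: bij_betw_def endo_inj_surj)
  moreover have "?t i = i" if "i \<notin> {1..n}" for i
    using that p(1) permutes_not_in[OF assms(1) that] by (auto simp: move_to_top_def p_def)
  ultimately show perm: "?t permutes {1..n}" by (rule bij_imp_permutes)
  have inv_t: "inv ?t a = (if inv \<sigma> a < inv \<sigma> c then inv \<sigma> a + 1 else inv \<sigma> a)"
    if "a \<in> {1..n} - {c}" for a
  proof -
    define q where "q = inv \<sigma> a"
    have q: "q \<in> {1..n}" "\<sigma> q = a"
      using mem[of a] that permutes_inverses(1)[OF assms(1)] by (simp_all add: q_def)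
    have "q \<noteq> p" using q p that by auto
    then have "?t (if q < p then q + 1 else q) = a"
      using q p unfolding move_to_top_def p_def[symmetric] by auto
    then have "inv ?t a = (if q < p then q + 1 else q)"
      by (simp only: permutes_inv_eq[OF perm])
    then show ?thesis by (simp only: p_def q_def)
  qed
  show "a \<in> {1..n} - {c} \<Longrightarrow>
      inv ?t a = (if inv \<sigma> a < inv \<sigma> c then inv \<sigma> a + 1 else inv \<sigma> a)"
    by (rule inv_t)
  show "inv ?t a < inv ?t b \<longleftrightarrow> inv \<sigma> a < inv \<sigma> b"
    if "a \<in> {1..n} - {c}" "b \<in> {1..n} - {c}"
  proof -
    have "inv \<sigma> a \<noteq> inv \<sigma> c" "inv \<sigma> b \<noteq> inv \<sigma> c"
      using that permutes_inverses(1)[OF assms(1)] by (metis DiffE singletonI)+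
    then show ?thesis by (simp only: inv_t[OF that(1)] inv_t[OF that(2)]) auto
  qed
qed

end

theory Submission
  imports Defs
begin

text \<open>After \<open>r\<close> shuffles the cards selected at least once lie on top, most recently selected first,
  and the other cards follow in increasing order. Relabelling the cards does not change the law of
  the selections, so given the set \<open>S\<close> of selected cards their order is uniform; it can therefore be
  taken to be the relative order of \<open>U\<^sub>1, \<dots>, U\<^sub>k\<close>, where \<open>k = card S\<close> has the law of the number of
  occupied boxes. The descents among the top \<open>k\<close> cards are then those of \<open>U\<^sub>1, \<dots>, U\<^sub>k\<close>, there is
  none among the remaining cards, and \<open>E\<close> is the indicator of a descent at the junction.\<close>

subsection \<open>Selected cards in order of recency\<close>

text \<open>Only the cards selected so far are recorded, most recent first; the others keep their
  initial order, so the list determines the deck. \<open>remove1\<close> drops the earlier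
  occurrence of a reselected card.\<close>

primrec top_list :: "nat \<Rightarrow> nat \<Rightarrow> nat list pmf" where
  "top_list n 0 = return_pmf []"
| "top_list n (Suc r) =
     bind_pmf (top_list n r) (\<lambda>xs. map_pmf (\<lambda>c. c # remove1 c xs) (pmf_of_set {1..n}))"

text \<open>Positions start at 1 and list indices at 0, hence the shift; outside the deck the value
  is \<open>i\<close>, as \<open>permutes\<close> demands.\<close>

definition deck_of :: "nat \<Rightarrow> nat list \<Rightarrow> nat \<Rightarrow> nat" where
  "deck_of n L i = (if i \<in> {1..n} then L ! (i - 1) else i)"

definition complete_deck :: "nat \<Rightarrow> nat list \<Rightarrow> nat list" where
  "complete_deck n xs = xs @ sorted_list_of_set ({1..n} - set xs)"

definition list_descents :: "'a::linorder list \<Rightarrow> nat" where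
  "list_descents xs = card {i. Suc i < length xs \<and> xs ! i > xs ! Suc i}"

lemma complete_deck_permutation:
  assumes "distinct xs" "set xs \<subseteq> {1..n}"
  shows "complete_deck n xs \<in> permutations_of_set {1..n}"
  using assms by (auto simp: complete_deck_def permutations_of_set_def)

lemma deck_of_permutes:
  assumes "L \<in> permutations_of_set {1..n}"
  shows "deck_of n L permutes {1..n}"
proof -
  have L: "distinct L" "set L = {1..n}" "length L = n"
    using permutations_of_setD[OF assms] length_finite_permutations_of_set[OF assms] by auto
  have "bij_betw (\<lambda>i. i - 1) {1..n} {..<n}"
    by (rule bij_betw_byWitness[where f' = Suc]) auto
  moreover have "bij_betw ((!) L) {..<n} {1..n}"
    using L by (intro bij_betw_nth) auto
  ultimately have "bij_betw ((!) L \<circ> (\<lambda>i. i - 1)) {1..n} {1..n}"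
    by (rule bij_betw_trans)
  moreover have "bij_betw (deck_of n L) {1..n} {1..n} \<longleftrightarrow> bij_betw ((!) L \<circ> (\<lambda>i. i - 1)) {1..n} {1..n}"
    by (rule bij_betw_cong) (simp add: deck_of_def)
  ultimately show ?thesis
    by (intro bij_imp_permutes) (auto simp: deck_of_def)
qed

text \<open>Write \<open>L = as @ c # bs\<close>. Card \<open>c\<close> has position
  \<open>Suc (length as)\<close>, and exactly the cards of \<open>as\<close> move down by one, on
  both sides.\<close>

lemma move_to_top_deck_of:
  assumes L: "L \<in> permutations_of_set {1..n}" and c: "c \<in> {1..n}"
  shows "move_to_top c (deck_of n L) = deck_of n (c # remove1 c L)"
proof -
  have len: "length L = n" and "c \<in> set L"
    using permutations_of_setD[OF L] length_finite_permutations_of_set[OF L] c by auto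
  then obtain as bs where as: "L = as @ c # bs" "c \<notin> set as"
    using split_list_first by metis
  have "deck_of n L (Suc (length as)) = c"
    using len as by (auto simp: deck_of_def)
  then have inv: "inv (deck_of n L) c = Suc (length as)"
    using permutes_inv_eq[OF deck_of_permutes[OF L]] by metis
  show ?thesis
  proof
    fix i
    \<comment> \<open>In the last case the right side is entry \<open>j\<close> of
      \<open>remove1 c L\<close>, which is entry \<open>j\<close> of \<open>L\<close> inside
      \<open>as\<close> and entry \<open>Suc j\<close> after it.\<close>
    consider "i \<notin> {1..n}" | "i = 1" "i \<le> n" | j where "i = Suc (Suc j)" "i \<le> n"
      by (cases i; cases "i - 1") auto
    then show "move_to_top c (deck_of n L) i = deck_of n (c # remove1 c L) i"
    proof cases
      case 1
      then show ?thesis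
        using c len as unfolding move_to_top_def inv by (auto simp: deck_of_def)
    next
      case 2
      then show ?thesis by (simp add: move_to_top_def deck_of_def)
    next
      case 3
      then show ?thesis
        using len as unfolding move_to_top_def inv
        by (auto simp: deck_of_def remove1_append nth_append nth_Cons')
    qed
  qed
qed

text \<open>Either \<open>c\<close> was selected before and is deleted from \<open>xs\<close> while
  the tail stays the same, or it is new and is deleted from the tail, which stays sorted.\<close>

lemma complete_deck_Cons_remove1:
  assumes "distinct xs" "c \<in> {1..n}"
  shows "complete_deck n (c # remove1 c xs) = c # remove1 c (complete_deck n xs)"
proof (cases "c \<in> set xs")
  case True
  then have "{1..n} - insert c (set xs - {c}) = {1..n} - set xs" by auto
  then show ?thesis
    using assms True by (simp add: complete_deck_def remove1_append)
next
  case False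
  then have "{1..n} - insert c (set xs) = {1..n} - set xs - {c}" by auto
  then show ?thesis
    using assms False
    by (simp add: complete_deck_def remove1_append remove1_idem sorted_list_of_set_remove)
qed

lemma set_pmf_top_list:
  assumes "n \<ge> 1" "xs \<in> set_pmf (top_list n r)"
  shows "distinct xs" "set xs \<subseteq> {1..n}"
  using assms(2)
proof (induction r arbitrary: xs)
  case (Suc r)
  { case 1 then show ?case using Suc.IH assms(1) by auto }
  { case 2
    then obtain c ys where "c \<in> {1..n}" "ys \<in> set_pmf (top_list n r)" "xs = c # remove1 c ys"
      using assms(1) by auto
    then show ?case using Suc.IH(2)[of ys] set_remove1_subset[of c ys] by auto }
qed auto

text \<open>Completing a list to a deck commutes with moving a card to the top, so both chains can
  be driven by the same selections.\<close>

lemma iterated_random_to_top_eq: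
  assumes "n \<ge> 1"
  shows "iterated_random_to_top n r = map_pmf (\<lambda>xs. deck_of n (complete_deck n xs)) (top_list n r)"
proof (induction r)
  case 0
  \<comment> \<open>With nothing selected the completed deck is the increasing list, that is, the
    identity.\<close>
  have "sorted_list_of_set {1..n} = [1..<Suc n]"
    by (metis atLeastLessThanSuc_atLeastAtMost sorted_list_of_set_range)
  then show ?case by (auto simp: deck_of_def complete_deck_def fun_eq_iff simp del: upt_Suc)
next
  case (Suc r)
  have "random_to_top n (deck_of n (complete_deck n xs)) =
      map_pmf (\<lambda>c. deck_of n (complete_deck n (c # remove1 c xs))) (pmf_of_set {1..n})"
    if "xs \<in> set_pmf (top_list n r)" for xs
    unfolding random_to_top_def
    using assms set_pmf_top_list[OF assms that]
    by (intro map_pmf_cong refl)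
      (simp add: move_to_top_deck_of[OF complete_deck_permutation] complete_deck_Cons_remove1)
  then show ?case
    by (auto simp: Suc bind_map_pmf map_bind_pmf map_pmf_comp intro!: bind_pmf_cong)
qed

text \<open>Selecting a card inserts a uniform element into the set of selected cards, just as a
  further ball does to the set of occupied boxes. The sets themselves are compared because the later
  coupling needs more than their sizes.\<close>

lemma map_set_top_list:
  assumes "n \<ge> 1"
  shows "map_pmf set (top_list n r) =
    map_pmf (\<lambda>f. {b \<in> {1..n}. \<exists>j\<in>{1..r}. f j = b}) (Pi_pmf {1..r} 0 (\<lambda>_. pmf_of_set {1..n}))"
proof (induction r)
  case (Suc r)
  let ?U = "pmf_of_set {1..n}"
  let ?occ = "\<lambda>r f. {b \<in> {1..n}. \<exists>j\<in>{1..r}. f j = b}"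
  have ins: "{1..Suc r} = insert (Suc r) {1..r}" by auto
  have "map_pmf set (top_list n (Suc r)) =
      bind_pmf (top_list n r) (\<lambda>xs. map_pmf (\<lambda>c. insert c (set xs)) ?U)"
    using set_pmf_top_list[OF assms]
    by (auto simp: map_bind_pmf map_pmf_comp intro!: bind_pmf_cong map_pmf_cong)
  also have "\<dots> = bind_pmf (map_pmf set (top_list n r)) (\<lambda>S. map_pmf (\<lambda>c. insert c S) ?U)"
    by (simp add: bind_map_pmf)
  also have "\<dots> = bind_pmf (Pi_pmf {1..r} 0 (\<lambda>_. ?U)) (\<lambda>f. map_pmf (\<lambda>c. insert c (?occ r f)) ?U)"
    by (simp add: Suc bind_map_pmf)
  also have "\<dots> = bind_pmf (Pi_pmf {1..r} 0 (\<lambda>_. ?U))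
      (\<lambda>f. map_pmf (\<lambda>c. ?occ (Suc r) (f(Suc r := c))) ?U)"
  proof (intro bind_pmf_cong map_pmf_cong refl)
    fix f c assume "c \<in> set_pmf ?U"
    then have "c \<in> {1..n}" using assms by simp
    moreover have "(\<exists>j\<in>{1..r}. (f(Suc r := c)) j = b) \<longleftrightarrow> (\<exists>j\<in>{1..r}. f j = b)" for b
      by (intro bex_cong refl) auto
    ultimately show "insert c (?occ r f) = ?occ (Suc r) (f(Suc r := c))"
      unfolding ins bex_simps by auto
  qed
  \<comment> \<open>The draws are exchanged to match the recursion of \<open>Pi_pmf\<close>, in
    which the new coordinate comes first.\<close>
  also have "\<dots> = bind_pmf ?U (\<lambda>c. map_pmf (\<lambda>f. ?occ (Suc r) (f(Suc r := c)))
      (Pi_pmf {1..r} 0 (\<lambda>_. ?U)))"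
    unfolding map_pmf_def by (rule bind_commute_pmf)
  also have "\<dots> = map_pmf (?occ (Suc r)) (Pi_pmf {1..Suc r} 0 (\<lambda>_. ?U))"
    unfolding ins by (subst Pi_pmf_insert') (simp_all add: map_bind_pmf map_pmf_def bind_return_pmf bind_assoc_pmf)
  finally show ?case .
qed (auto simp: map_pmf_def bind_return_pmf)

section \<open>Symmetry under relabelling and conditional uniformity\<close>

text \<open>A permutation of the cards preserves the uniform selection and, being injective,
  commutes with \<open>remove1\<close>.\<close>

lemma top_list_relabel:
  assumes "n \<ge> 1" "\<pi> permutes {1..n}"
  shows "map_pmf (map \<pi>) (top_list n r) = top_list n r"
proof (induction r)
  case (Suc r)
  let ?U = "pmf_of_set {1..n}"
  have U: "map_pmf \<pi> ?U = ?U"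
    using assms by (intro map_pmf_of_set_bij_betw) (auto simp: permutes_imp_bij)
  have rem: "map \<pi> (remove1 c xs) = remove1 (\<pi> c) (map \<pi> xs)" for c xs
    using permutes_inj[OF assms(2)] by (induction xs) (auto dest: injD)
  have "map_pmf (map \<pi>) (top_list n (Suc r)) =
      bind_pmf (map_pmf (map \<pi>) (top_list n r)) (\<lambda>xs. map_pmf (\<lambda>c. c # remove1 c xs) (map_pmf \<pi> ?U))"
    by (simp add: map_bind_pmf bind_map_pmf map_pmf_comp rem)
  then show ?case by (simp only: Suc U top_list.simps)
qed simp

text \<open>Some relabelling of the cards carries \<open>xs\<close> to \<open>ys\<close>, so
  invariance under relabelling equates their masses.\<close>

lemma pmf_top_list_eq:
  assumes "n \<ge> 1" "set xs \<subseteq> {1..n}" "distinct xs" "distinct ys" "set xs = set ys"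
  shows "pmf (top_list n r) xs = pmf (top_list n r) ys"
proof -
  \<comment> \<open>\<open>g\<close> sends each entry of \<open>xs\<close> to the entry of
    \<open>ys\<close> at the same index and fixes every other card.\<close>
  define g where "g = (\<lambda>x. if x \<in> set xs then the (map_of (zip xs ys) x) else x)"
  have len: "length xs = length ys" using assms by (metis distinct_card)
  have g: "g (xs ! i) = ys ! i" if "i < length xs" for i
    using that len assms(3) by (simp add: g_def map_of_zip_nth)
  have map: "map g xs = ys" using g len by (intro nth_equalityI) auto
  have "bij_betw g (set xs) (set xs)"
    using map assms len by (metis bij_betw_def distinct_map list.set_map)
  then have "g permutes set xs"
    by (rule bij_imp_permutes) (simp add: g_def)
  then have perm: "g permutes {1..n}" using assms(2) by (rule permutes_subset)
  have "pmf (top_list n r) xs = pmf (map_pmf (map g) (top_list n r)) (map g xs)"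
    using permutes_inj[OF perm] by (intro pmf_map_inj'[symmetric]) simp
  then show ?thesis by (simp add: top_list_relabel[OF assms(1) perm] map)
qed

text \<open>All orders of a given set of selected cards have equal mass, so redrawing the order
  uniformly does not change the law.\<close>

lemma top_list_conditionally_uniform:
  assumes "n \<ge> 1"
  shows "top_list n r =
    bind_pmf (map_pmf set (top_list n r)) (\<lambda>S. pmf_of_set (permutations_of_set S))"
proof (rule pmf_eqI)
  fix xs :: "nat list"
  let ?A = "top_list n r" and ?P = "permutations_of_set (set xs)"
  have fin: "finite ?P" "?P \<noteq> {}" by auto
  have "pmf (bind_pmf (map_pmf set ?A) (\<lambda>S. pmf_of_set (permutations_of_set S))) xs
      = measure_pmf.expectation ?A (\<lambda>ys. pmf (pmf_of_set (permutations_of_set (set ys))) xs)"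
    by (simp add: bind_map_pmf pmf_bind)
  \<comment> \<open>For distinct \<open>ys\<close> the redrawn list can equal \<open>xs\<close> only
    if both are orders of the same set; then the chance is \<open>1 / card ?P\<close>.\<close>
  also have "\<dots> = measure_pmf.expectation ?A (\<lambda>ys. indicator ?P ys * indicator ?P xs / real (card ?P))"
  proof (intro integral_cong_AE)
    have "pmf (pmf_of_set (permutations_of_set (set ys))) xs =
        indicator ?P ys * indicator ?P xs / real (card ?P)" if "distinct ys" for ys
    proof (cases "set ys = set xs")
      case True
      then show ?thesis using that fin by (simp add: permutations_of_setI)
    next
      case False
      then have "xs \<notin> permutations_of_set (set ys)" "ys \<notin> ?P"
        by (auto dest: permutations_of_setD)
      then show ?thesis by (simp add: permutations_of_set_nonempty)
    qed
    then show "AE ys in ?A. pmf (pmf_of_set (permutations_of_set (set ys))) xs =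
        indicator ?P ys * indicator ?P xs / real (card ?P)"
      using set_pmf_top_list(1)[OF assms] by (auto simp: AE_measure_pmf_iff)
  qed auto
  also have "\<dots> = measure ?A ?P * indicator ?P xs / real (card ?P)"
    by simp
  \<comment> \<open>If \<open>xs\<close> is an admissible list, \<open>?P\<close> consists of
    \<open>card ?P\<close> lists, each with the mass of \<open>xs\<close>. Otherwise both sides
    vanish.\<close>
  also have "\<dots> = pmf ?A xs"
  proof (cases "distinct xs \<and> set xs \<subseteq> {1..n}")
    case True
    then have "measure ?A ?P = (\<Sum>ys\<in>?P. pmf ?A xs)"
      unfolding measure_measure_pmf_finite[OF fin(1)]
      using pmf_top_list_eq[OF assms]
      by (intro sum.cong refl) (auto simp: permutations_of_set_def)
    then show ?thesis using True fin by (simp add: permutations_of_set_def)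
  next
    case False
    then have "xs \<notin> set_pmf ?A" using set_pmf_top_list[OF assms] by blast
    moreover have "ys \<notin> set_pmf ?A" if "ys \<in> ?P" "xs \<in> ?P" for ys
      using that False set_pmf_top_list[OF assms] permutations_of_setD by metis
    then have "measure ?A ?P = 0" if "xs \<in> ?P"
      using that by (subst measure_measure_pmf_finite[OF fin(1)]) (auto simp: set_pmf_iff)
    ultimately show ?thesis by (auto simp: set_pmf_iff indicator_def)
  qed
  finally show "pmf ?A xs = pmf (bind_pmf (map_pmf set ?A) (\<lambda>S. pmf_of_set (permutations_of_set S))) xs" ..
qed

section \<open>Descents of a completed deck\<close>

text \<open>The sorted part has no descents, so besides those within \<open>xs\<close> only the
  junction at index \<open>length xs - 1\<close> can contribute.\<close>

lemma list_descents_append_sorted: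
  assumes "sorted ys"
  shows "list_descents (xs @ ys) =
    list_descents xs + (if xs \<noteq> [] \<and> ys \<noteq> [] \<and> last xs > hd ys then 1 else 0)"
proof -
  let ?D = "\<lambda>xs. {i. Suc i < length xs \<and> xs ! i > xs ! Suc i}"
  let ?J = "if xs \<noteq> [] \<and> ys \<noteq> [] \<and> last xs > hd ys then {length xs - 1} else {}"
  have "i \<in> ?D (xs @ ys) \<longleftrightarrow> i \<in> ?D xs \<union> ?J" for i
  proof -
    consider "Suc i < length xs" | "Suc i = length xs" | "length xs \<le> i" by linarith
    then show ?thesis
    proof cases
      case 1 then show ?thesis by (auto simp: nth_append)
    next
      case 2
      then have "xs \<noteq> []" "i = length xs - 1" by auto
      then show ?thesis using 2
        by (auto simp: nth_append last_conv_nth hd_conv_nth)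
    next
      case 3
      have "ys ! (i - length xs) \<le> ys ! (Suc i - length xs)" if "Suc i < length (xs @ ys)"
        using that 3 by (intro sorted_nth_mono[OF assms]) auto
      then have "i \<notin> ?D (xs @ ys)" using 3 by (fastforce simp: nth_append not_less)
      moreover have "i \<notin> ?D xs \<union> ?J" using 3 by (cases xs) auto
      ultimately show ?thesis by blast
    qed
  qed
  then have "?D (xs @ ys) = ?D xs \<union> ?J" by blast
  moreover have "card (?D xs \<union> ?J) = card (?D xs) + card ?J"
    by (intro card_Un_disjoint) (auto intro: finite_subset[of _ "{..<length xs}"])
  ultimately show ?thesis by (simp add: list_descents_def)
qed

lemma descents_deck_of:
  assumes "length L = n"
  shows "descents n (deck_of n L) = list_descents L"
proof -
  have "{i \<in> {1..<n}. deck_of n L i > deck_of n L (i + 1)} =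
      Suc ` {i. Suc i < length L \<and> L ! i > L ! Suc i}"
  proof (intro set_eqI)
    fix i show "i \<in> {i \<in> {1..<n}. deck_of n L i > deck_of n L (i + 1)} \<longleftrightarrow>
      i \<in> Suc ` {i. Suc i < length L \<and> L ! i > L ! Suc i}"
      using assms by (cases i) (auto simp: deck_of_def)
  qed
  then show ?thesis by (simp add: descents_def list_descents_def card_image)
qed

subsection \<open>Arranging a set in the relative order of uniform variables\<close>

text \<open>A list of elements of \<open>S\<close> for every \<open>v\<close>, but a permutation of \<open>S\<close> only if
  \<open>v\<close> has no ties.\<close>

definition arrangement :: "'a::linorder set \<Rightarrow> (nat \<Rightarrow> real) \<Rightarrow> 'a list" where
  "arrangement S v =
     map (\<lambda>i. sorted_list_of_set S ! card {j. j < card S \<and> v j < v i}) [0..<card S]"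

lemma length_arrangement [simp]: "length (arrangement S v) = card S"
  by (simp add: arrangement_def)

text \<open>An index is never counted in its own rank, so the rank is a valid index even in the
  presence of ties.\<close>

lemma rank_less:
  fixes v :: "nat \<Rightarrow> real"
  assumes "i < k"
  shows "card {j. j < k \<and> v j < v i} < k"
proof -
  have "card {j. j < k \<and> v j < v i} < card {..<k}"
    using assms by (intro psubset_card_mono) auto
  then show ?thesis by simp
qed

lemma rank_less_iff:
  fixes v :: "nat \<Rightarrow> real"
  assumes "a < k" "b < k"
  shows "card {j. j < k \<and> v j < v a} < card {j. j < k \<and> v j < v b} \<longleftrightarrow> v a < v b"
proof (cases "v a < v b")
  case True
  then have "card {j. j < k \<and> v j < v a} < card {j. j < k \<and> v j < v b}"
    using assms by (intro psubset_card_mono) auto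
  then show ?thesis using True by simp
next
  case False
  then have "card {j. j < k \<and> v j < v b} \<le> card {j. j < k \<and> v j < v a}"
    by (intro card_mono) auto
  then show ?thesis using False by simp
qed

text \<open>The sorted list is strictly increasing, so entries compare as their ranks do, and ranks
  compare as the values of \<open>v\<close> do.\<close>

lemma arrangement_nth_less_iff:
  assumes "a < card S" "b < card S"
  shows "arrangement S v ! a < arrangement S v ! b \<longleftrightarrow> v a < v b"
proof -
  have "sorted_list_of_set S ! x < sorted_list_of_set S ! y \<longleftrightarrow> x < y"
    if "x < card S" "y < card S" for x y
    using that strict_sorted_list_of_set[of S]
    by (metis length_sorted_list_of_set linorder_neqE_nat order_less_asym sorted_wrt_nth_less order_less_irrefl)
  then show ?thesis
    using assms by (simp add: arrangement_def rank_less rank_less_iff)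
qed

lemma arrangement_permutation:
  assumes "finite S" "inj_on v {..<card S}"
  shows "arrangement S v \<in> permutations_of_set S"
proof -
  have nth: "arrangement S v ! i \<in> S" if "i < card S" for i
    using that rank_less[of i "card S" v] assms(1)
    by (simp add: arrangement_def) (metis length_sorted_list_of_set nth_mem set_sorted_list_of_set)
  have dist: "distinct (arrangement S v)"
    unfolding distinct_conv_nth length_arrangement
    using arrangement_nth_less_iff[of _ S _ v] assms(2)
    by (metis inj_onD lessThan_iff linorder_neqE order_less_irrefl)
  moreover have "set (arrangement S v) \<subseteq> S"
    using nth by (auto simp: in_set_conv_nth)
  then have "set (arrangement S v) = S"
    using dist assms(1) by (intro card_subset_eq) (simp_all add: distinct_card)
  ultimately show ?thesis by (intro permutations_of_setI)
qed

text \<open>Tied values give equal entries and thus no descent on either side, so the identity holds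
  at every outcome and not just almost surely.\<close>

lemma list_descents_arrangement:
  "list_descents (arrangement S v) = card {i. Suc i < card S \<and> v i > v (Suc i)}"
proof -
  have "{i. Suc i < card S \<and> arrangement S v ! i > arrangement S v ! Suc i} =
      {i. Suc i < card S \<and> v i > v (Suc i)}"
    using arrangement_nth_less_iff by (metis Suc_lessD)
  then show ?thesis by (simp add: list_descents_def)
qed

text \<open>\<open>\<pi>\<close> maps the indices counted in the rank of \<open>i\<close> under
  \<open>v \<circ> \<pi>\<close> bijectively to those counted in the rank of \<open>\<pi> i\<close>
  under \<open>v\<close>.\<close>

lemma arrangement_permute:
  assumes "\<pi> permutes {..<card S}"
  shows "arrangement S (v \<circ> \<pi>) = permute_list \<pi> (arrangement S v)"
proof (rule nth_equalityI)
  fix i assume "i < length (arrangement S (v \<circ> \<pi>))"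
  then have i: "i < card S" by simp
  have \<pi>i: "\<pi> i < card S" using permutes_in_image[OF assms] i by auto
  have "bij_betw \<pi> {j. j < card S \<and> v (\<pi> j) < v (\<pi> i)} {j. j < card S \<and> v j < v (\<pi> i)}"
  proof (rule bij_betw_byWitness[where f' = "inv \<pi>"])
  qed (use permutes_inverses[OF assms] permutes_in_image[OF assms]
      permutes_in_image[OF permutes_inv[OF assms]] in auto)
  then show "arrangement S (v \<circ> \<pi>) ! i = permute_list \<pi> (arrangement S v) ! i"
    using i \<pi>i assms by (simp add: permute_list_nth arrangement_def bij_betw_same_card)
qed simp

lemma arrangement_cong:
  assumes "\<And>j. j < card S \<Longrightarrow> v j = w j"
  shows "arrangement S v = arrangement S w"
proof -
  have "{j. j < card S \<and> v j < v i} = {j. j < card S \<and> w j < w i}" if "i < card S" for i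
    using assms that by auto
  then show ?thesis by (simp add: arrangement_def)
qed

section \<open>Independent uniform variables: measurability and absence of ties\<close>

abbreviation unit_uniform :: "real measure" where
  "unit_uniform \<equiv> uniform_measure lborel {0<..<1}"

lemma prob_space_unit_uniform: "prob_space unit_uniform"
  by (rule prob_space_uniform_measure) auto

abbreviation uniform_vector :: "nat \<Rightarrow> (nat \<Rightarrow> real) measure" where
  "uniform_vector n \<equiv> PiM {1..n} (\<lambda>_. unit_uniform)"

lemma prob_space_uniform_vector: "prob_space (uniform_vector n)"
  by (intro prob_space_PiM prob_space_unit_uniform)

lemma measurable_uniform_vector_component:
  assumes "i \<in> {1..n}"
  shows "(\<lambda>u. u i) \<in> borel_measurable (uniform_vector n)"
proof -
  have "measurable (uniform_vector n) unit_uniform = borel_measurable (uniform_vector n)"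
    by (rule measurable_cong_sets) simp_all
  then show ?thesis
    using measurable_component_singleton[OF assms, of "\<lambda>_. unit_uniform"] by metis
qed

text \<open>There are countably many lists, so it suffices that each single list has a measurable
  preimage.\<close>

lemma measurable_arrangement:
  fixes S :: "'a::{linorder,countable} set"
  assumes "finite S" "card S \<le> n"
  shows "(\<lambda>u. arrangement S (\<lambda>j. u (Suc j))) \<in> measurable (uniform_vector n) (count_space UNIV)"
proof -
  have [measurable]: "(\<lambda>u. u (Suc j)) \<in> borel_measurable (uniform_vector n)" if "j < card S" for j
    using that assms by (intro measurable_uniform_vector_component) auto
  have "{u \<in> space (uniform_vector n). arrangement S (\<lambda>j. u (Suc j)) = xs} \<in> sets (uniform_vector n)" for xs
  proof -
    \<comment> \<open>As finite sums of indicators, the ranks are visibly measurable functions of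
      the coordinates.\<close>
    have rank: "card {j. j < card S \<and> P j} = (\<Sum>j<card S. if P j then 1 else 0)" for P
      by (simp add: sum.If_cases lessThan_def Int_def)
    have "{u \<in> space (uniform_vector n). arrangement S (\<lambda>j. u (Suc j)) = xs} =
      {u \<in> space (uniform_vector n). length xs = card S \<and> (\<forall>i\<in>{..<card S}.
        sorted_list_of_set S ! (\<Sum>j<card S. if u (Suc j) < u (Suc i) then 1 else 0) = xs ! i)}"
      unfolding list_eq_iff_nth_eq length_arrangement by (auto simp: arrangement_def rank)
    also have "\<dots> \<in> sets (uniform_vector n)" by measurable
    finally show ?thesis .
  qed
  then show ?thesis
    by (subst measurable_count_space_eq2_countable) (auto simp: vimage_def Int_def conj_commute)
qed

text \<open>Splitting off coordinate \<open>i\<close> and fixing its value \<open>x\<close>,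
  coordinate \<open>j\<close> equals \<open>x\<close> with probability zero; Fubini and finiteness
  of the number of pairs give the claim.\<close>

lemma AE_uniform_vector_inj:
  "AE u in uniform_vector n. inj_on u {1..n}"
proof -
  interpret U: prob_space unit_uniform by (rule prob_space_unit_uniform)
  interpret prob_space "uniform_vector n" by (rule prob_space_uniform_vector)
  have "AE u in uniform_vector n. u i \<noteq> u j" if ij: "i \<in> {1..n}" "j \<in> {1..n}" "i \<noteq> j" for i j
  proof -
    let ?V = "PiM ({1..n} - {i}) (\<lambda>_. unit_uniform)"
    interpret V: prob_space ?V by (intro prob_space_PiM prob_space_unit_uniform)
    interpret P: pair_sigma_finite unit_uniform ?V ..
    have [measurable]: "(\<lambda>X. X j) \<in> borel_measurable ?V"
      using ij measurable_component_singleton[of j "{1..n} - {i}" "\<lambda>_. unit_uniform"] by simp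
    have "AE y in unit_uniform. x \<noteq> y" for x
      by (rule AE_uniform_measureI) (use AE_lborel_singleton[of x] in auto)
    then have ne: "AE X in ?V. x \<noteq> X j" for x
      using ij by (intro AE_PiM_component prob_space_unit_uniform) auto
    have [measurable]: "fst \<in> borel_measurable (unit_uniform \<Otimes>\<^sub>M ?V)"
      using measurable_fst[of unit_uniform ?V] by (simp cong: measurable_cong_sets)
    have [measurable]: "(\<lambda>z. snd z j) \<in> borel_measurable (unit_uniform \<Otimes>\<^sub>M ?V)"
      by measurable
    have "{z \<in> space (unit_uniform \<Otimes>\<^sub>M ?V). fst z \<noteq> snd z j} \<in> sets (unit_uniform \<Otimes>\<^sub>M ?V)"
      by measurable
    then have AE: "AE z in unit_uniform \<Otimes>\<^sub>M ?V. fst z \<noteq> snd z j"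
      using ne by (intro P.AE_pair_measure) simp_all
    have meas: "(\<lambda>(x, X). X(i := x)) \<in> measurable (unit_uniform \<Otimes>\<^sub>M ?V) (uniform_vector n)"
      using ij measurable_compose[OF measurable_pair_swap'
          measurable_add_dim[of i "{1..n} - {i}" "\<lambda>_. unit_uniform"]]
      by (simp add: insert_absorb split_beta')
    \<comment> \<open>Putting the separate coordinate back recovers the full product law, so the
      null set transfers.\<close>
    have "distr (unit_uniform \<Otimes>\<^sub>M ?V) (uniform_vector n) (\<lambda>(x, X). X(i := x)) = uniform_vector n"
      using distr_pair_PiM_eq_PiM[of "{1..n} - {i}" "\<lambda>_. unit_uniform" i] prob_space_unit_uniform ij
      by (simp add: insert_absorb)
    moreover have "AE u in distr (unit_uniform \<Otimes>\<^sub>M ?V) (uniform_vector n) (\<lambda>(x, X). X(i := x)). u i \<noteq> u j"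
    proof (subst AE_distr_iff[OF meas])
      show "{u \<in> space (uniform_vector n). u i \<noteq> u j} \<in> sets (uniform_vector n)"
        by (intro borel_measurable_neq measurable_uniform_vector_component ij)
    qed (use AE ij in \<open>simp add: split_beta'\<close>)
    ultimately show ?thesis by metis
  qed
  then have "AE u in uniform_vector n. \<forall>i\<in>{1..n}. \<forall>j\<in>{1..n}. i \<noteq> j \<longrightarrow> u i \<noteq> u j"
    by (intro AE_finite_allI) auto
  then show ?thesis by eventually_elim (auto simp: inj_on_def)
qed

text \<open>Permuting coordinates preserves the law of the vector and permutes the arrangement, so
  all permutations of \<open>S\<close> are equally likely; since ties are null, these masses sum to
  one.\<close>

lemma distr_arrangement:
  fixes S :: "'a::{linorder,countable} set"
  assumes "finite S" "card S \<le> n"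
  shows "distr (uniform_vector n) (count_space UNIV) (\<lambda>u. arrangement S (\<lambda>j. u (Suc j))) =
    measure_pmf (pmf_of_set (permutations_of_set S))"
proof -
  let ?Q = "uniform_vector n" and ?P = "permutations_of_set S"
  let ?D = "distr ?Q (count_space UNIV) (\<lambda>u. arrangement S (\<lambda>j. u (Suc j)))"
  note meas = measurable_arrangement[OF assms]
  interpret D: prob_space ?D
    by (rule prob_space.prob_space_distr[OF prob_space_uniform_vector meas])
  have "AE u in ?Q. arrangement S (\<lambda>j. u (Suc j)) \<in> ?P"
    using AE_uniform_vector_inj[of n]
  proof eventually_elim
    case (elim u)
    have "inj_on (\<lambda>j. u (Suc j)) {..<card S}"
      using assms(2) by (intro inj_onI) (use inj_onD[OF elim] in fastforce)
    then show ?case by (rule arrangement_permutation[OF assms(1)])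
  qed
  then have AE: "AE xs in ?D. xs \<in> ?P"
    by (subst AE_distr_iff[OF meas]) auto
  have eq: "measure ?D {xs} = measure ?D {ys}" if xs: "xs \<in> ?P" and ys: "ys \<in> ?P" for xs ys
  proof -
    have len: "length xs = card S" "length ys = card S"
      using xs ys by (simp_all add: length_finite_permutations_of_set)
    have "mset xs = mset ys"
      using xs ys by (metis permutations_of_setD set_eq_iff_mset_eq_distinct)
    then obtain \<pi> where \<pi>: "\<pi> permutes {..<card S}" "permute_list \<pi> ys = xs"
      using mset_eq_permutation[of xs ys] len by auto
    \<comment> \<open>\<open>\<rho>\<close> is \<open>\<pi>\<close> shifted to coordinates that
      start at 1; coordinates beyond \<open>card S\<close> stay fixed because \<open>\<pi>\<close>
      fixes their indices.\<close>
    define \<rho> where "\<rho> i = (case i of 0 \<Rightarrow> 0 | Suc j \<Rightarrow> Suc (\<pi> j))" for i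
    have inj: "inj \<rho>"
      unfolding \<rho>_def by (intro injI) (use permutes_inj[OF \<pi>(1)] in \<open>auto split: nat.splits dest: injD\<close>)
    have maps: "\<rho> \<in> {1..n} \<rightarrow> {1..n}"
    proof
      fix i assume "i \<in> {1..n}"
      then obtain j where "i = Suc j" "j < n" by (cases i) auto
      then show "\<rho> i \<in> {1..n}"
        using permutes_in_image[OF \<pi>(1), of j] permutes_not_in[OF \<pi>(1), of j] assms(2)
        by (cases "j < card S") (auto simp: \<rho>_def)
    qed
    define T where "T u = (\<lambda>i\<in>{1..n}. u (\<rho> i) :: real)" for u
    have T: "distr ?Q ?Q T = ?Q"
      unfolding T_def
      using distr_PiM_reindex[of "{1..n}" "\<lambda>_. unit_uniform" \<rho> "{1..n}"] maps
        inj_on_subset[OF inj subset_UNIV] prob_space_unit_uniform by simp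
    have T_meas: "T \<in> measurable ?Q ?Q"
      unfolding T_def using maps by (intro measurable_restrict measurable_component_singleton) auto
    have arr: "arrangement S (\<lambda>j. T u (Suc j)) = permute_list \<pi> (arrangement S (\<lambda>j. u (Suc j)))" for u
    proof -
      have "arrangement S (\<lambda>j. T u (Suc j)) = arrangement S ((\<lambda>j. u (Suc j)) \<circ> \<pi>)"
        using assms(2) by (intro arrangement_cong) (auto simp: T_def \<rho>_def)
      then show ?thesis by (simp add: arrangement_permute[OF \<pi>(1)])
    qed
    have perm_meas: "(\<lambda>zs. permute_list \<pi> zs) \<in> measurable (count_space UNIV) (count_space UNIV)"
      by simp
    have "?D = distr (distr ?Q ?Q T) (count_space UNIV) (\<lambda>u. arrangement S (\<lambda>j. u (Suc j)))"
      by (simp only: T)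
    also have "\<dots> = distr ?D (count_space UNIV) (permute_list \<pi>)"
      by (simp only: distr_distr[OF meas T_meas] distr_distr[OF perm_meas meas] comp_def arr)
    finally have "measure ?D {xs} = measure (distr ?D (count_space UNIV) (permute_list \<pi>)) {xs}"
      by (rule arg_cong)
    also have "\<dots> = measure ?D (permute_list \<pi> -` {xs} \<inter> space ?D)"
      by (rule measure_distr) auto
    also have "\<dots> = measure ?D {ys}"
    proof (rule measure_eq_AE)
      \<comment> \<open>Among lists of length \<open>card S\<close> the action of
        \<open>\<pi>\<close> is injective; restricting to \<open>?P\<close> loses only a null
        set.\<close>
      have "permute_list \<pi> zs = xs \<longleftrightarrow> zs = ys" if "zs \<in> ?P" for zs
      proof
        have zs: "length zs = card S" using that by (rule length_finite_permutations_of_set)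
        assume eq: "permute_list \<pi> zs = xs"
        show "zs = ys"
        proof (rule nth_equalityI)
          fix i assume "i < length zs"
          then have i: "i < card S" by (simp add: zs)
          then have "inv \<pi> i < card S"
            using permutes_in_image[OF permutes_inv[OF \<pi>(1)], of i] by simp
          then have "zs ! \<pi> (inv \<pi> i) = ys ! \<pi> (inv \<pi> i)"
            using eq \<pi> zs len by (metis permute_list_nth)
          then show "zs ! i = ys ! i"
            by (simp add: permutes_inverses(1)[OF \<pi>(1)])
        qed (simp add: zs len)
      qed (use \<pi> in simp)
      then show "AE zs in ?D. zs \<in> permute_list \<pi> -` {xs} \<inter> space ?D \<longleftrightarrow> zs \<in> {ys}"
        by (intro AE_mp[OF AE AE_I2]) simp
    qed auto
    finally show ?thesis .
  qed
  show ?thesis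
  proof (rule measure_eqI_countable_AE)
    show "emeasure ?D {xs} = emeasure (pmf_of_set ?P) {xs}" if xs: "xs \<in> ?P" for xs
    proof -
      have "measure ?D ?P = 1" using AE by (subst D.prob_eq_1) auto
      then have "1 = measure ?D ?P" ..
      also have "\<dots> = (\<Sum>ys\<in>?P. measure ?D {ys})"
        using assms(1) by (intro D.finite_measure_eq_sum_singleton) auto
      also have "\<dots> = real (card ?P) * measure ?D {xs}"
        using eq[OF _ xs] by simp
      finally have "measure ?D {xs} = 1 / real (card ?P)"
        using assms(1) by (simp add: eq_divide_eq mult.commute)
      moreover have "measure (pmf_of_set ?P) {xs} = 1 / real (card ?P)"
        using xs assms(1) by (simp add: measure_pmf_single)
      ultimately show ?thesis
        unfolding D.emeasure_eq_measure measure_pmf.emeasure_eq_measure by (simp only:)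
    qed
  qed (use AE assms in \<open>auto simp: AE_measure_pmf_iff\<close>)
qed

subsection \<open>The coupling\<close>

text \<open>As \<open>N\<close> has total mass one, the second projection has law
  \<open>uniform_vector n\<close>, a product of its marginals.\<close>

lemma indep_vars_uniform_vector_coordinates:
  assumes "n \<ge> 1" "prob_space N"
  shows "prob_space.indep_vars (N \<Otimes>\<^sub>M uniform_vector n) (\<lambda>_. borel) (\<lambda>i \<omega>. snd \<omega> i) {1..n}"
    and "i \<in> {1..n} \<Longrightarrow> distr (N \<Otimes>\<^sub>M uniform_vector n) borel (\<lambda>\<omega>. snd \<omega> i) = unit_uniform"
    and "i \<in> {1..n} \<Longrightarrow> (\<lambda>\<omega>. snd \<omega> i) \<in> borel_measurable (N \<Otimes>\<^sub>M uniform_vector n)"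
proof -
  interpret N: prob_space N by fact
  interpret Q: prob_space "uniform_vector n" by (rule prob_space_uniform_vector)
  interpret P: pair_prob_space N "uniform_vector n" ..
  let ?M = "N \<Otimes>\<^sub>M uniform_vector n"
  note coord = measurable_uniform_vector_component
  show meas: "(\<lambda>\<omega>. snd \<omega> i) \<in> borel_measurable ?M" if "i \<in> {1..n}" for i
    by (rule measurable_compose[OF measurable_snd coord[OF that]])
  have snd: "distr ?M (uniform_vector n) snd = uniform_vector n"
  proof (rule measure_eqI)
    fix A assume "A \<in> sets (distr ?M (uniform_vector n) snd)"
    then have A: "A \<in> sets (uniform_vector n)" by simp
    have "emeasure (distr ?M (uniform_vector n) snd) A = emeasure ?M (snd -` A \<inter> space ?M)"
      by (rule emeasure_distr[OF measurable_snd A])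
    also have "snd -` A \<inter> space ?M = space N \<times> A"
      using sets.sets_into_space[OF A] by (auto simp: space_pair_measure)
    also have "emeasure ?M (space N \<times> A) = emeasure N (space N) * emeasure (uniform_vector n) A"
      by (rule Q.emeasure_pair_measure_Times[OF sets.top A])
    finally show "emeasure (distr ?M (uniform_vector n) snd) A = emeasure (uniform_vector n) A"
      by (simp add: N.emeasure_space_1)
  qed simp
  have "distr (uniform_vector n) borel (\<lambda>u. u i) = unit_uniform" if "i \<in> {1..n}" for i
  proof -
    have "distr (uniform_vector n) borel (\<lambda>u. u i) = distr (uniform_vector n) unit_uniform (\<lambda>u. u i)"
      by (rule distr_cong) simp_all
    also have "\<dots> = unit_uniform"
      by (rule distr_PiM_component[OF prob_space_unit_uniform that])
    finally show ?thesis .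
  qed
  then show distr: "distr ?M borel (\<lambda>\<omega>. snd \<omega> i) = unit_uniform" if "i \<in> {1..n}" for i
    using distr_distr[OF coord measurable_snd, OF that, of N] snd that by (simp add: comp_def)
  \<comment> \<open>Vectors in the product space are extensional, so the restriction leaves them
    unchanged.\<close>
  have "distr ?M (PiM {1..n} (\<lambda>_. borel)) (\<lambda>\<omega>. \<lambda>i\<in>{1..n}. snd \<omega> i) = distr ?M (uniform_vector n) snd"
    by (intro distr_cong sets_PiM_cong) (auto simp: space_pair_measure space_PiM PiE_def extensional_restrict)
  also have "\<dots> = PiM {1..n} (\<lambda>i. distr ?M borel (\<lambda>\<omega>. snd \<omega> i))"
    unfolding snd by (intro PiM_cong refl distr[symmetric])
  finally show "P.indep_vars (\<lambda>_. borel) (\<lambda>i \<omega>. snd \<omega> i) {1..n}"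
    using assms(1) meas by (subst P.indep_vars_iff_distr_eq_PiM') auto
qed

text \<open>Events generated by one factor are cylinders, and two cylinders over different factors
  meet in a rectangle, whose measure is a product.\<close>

lemma indep_set_fst_snd:
  assumes "prob_space N" "prob_space Q" "f \<in> measurable N A" "g \<in> measurable Q B"
  shows "prob_space.indep_set (N \<Otimes>\<^sub>M Q)
    (sets (vimage_algebra (space (N \<Otimes>\<^sub>M Q)) (\<lambda>\<omega>. f (fst \<omega>)) A))
    (sets (vimage_algebra (space (N \<Otimes>\<^sub>M Q)) (\<lambda>\<omega>. g (snd \<omega>)) B))"
proof -
  interpret N: prob_space N by fact
  interpret Q: prob_space Q by fact
  interpret P: pair_prob_space N Q ..
  let ?M = "N \<Otimes>\<^sub>M Q"
  have F: "sets (vimage_algebra (space ?M) (\<lambda>\<omega>. f (fst \<omega>)) A) = {(f -` X \<inter> space N) \<times> space Q | X. X \<in> sets A}"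
    using measurable_space[OF assms(3)]
    by (subst sets_vimage_algebra2) (auto simp: space_pair_measure intro!: Collect_cong ex_cong1)
  have G: "sets (vimage_algebra (space ?M) (\<lambda>\<omega>. g (snd \<omega>)) B) = {space N \<times> (g -` X \<inter> space Q) | X. X \<in> sets B}"
    using measurable_space[OF assms(4)]
    by (subst sets_vimage_algebra2) (auto simp: space_pair_measure intro!: Collect_cong ex_cong1)
  have times: "P.prob (X \<times> Y) = N.prob X * Q.prob Y" if "X \<in> sets N" "Y \<in> sets Q" for X Y
    unfolding measure_def Q.emeasure_pair_measure_Times[OF that] by (rule enn2real_mult)
  show ?thesis
    unfolding F G
  proof (rule P.indep_setI)
    fix X Y assume "X \<in> {(f -` X \<inter> space N) \<times> space Q | X. X \<in> sets A}"
      and "Y \<in> {space N \<times> (g -` X \<inter> space Q) | X. X \<in> sets B}"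
    then obtain X' Y' where "X = X' \<times> space Q" "Y = space N \<times> Y'" "X' \<in> sets N" "Y' \<in> sets Q"
      by (blast intro: measurable_sets[OF assms(3)] measurable_sets[OF assms(4)])
    moreover from this have "X \<inter> Y = X' \<times> Y'"
      using sets.sets_into_space[of X' N] sets.sets_into_space[of Y' Q] by auto
    ultimately show "P.prob (X \<inter> Y) = P.prob X * P.prob Y"
      by (simp add: times N.prob_space Q.prob_space)
  qed (blast intro: pair_measureI measurable_sets[OF assms(3)] measurable_sets[OF assms(4)] sets.top)+
qed

text \<open>The first card of the sorted tail is the least card never selected, which makes the
  junction term a function of \<open>xs\<close> alone.\<close>

lemma list_descents_complete_deck:
  "list_descents (complete_deck n xs) = list_descents xs +
    (if xs \<noteq> [] \<and> {1..n} - set xs \<noteq> {} \<and> last xs > Min ({1..n} - set xs) then 1 else 0)"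
proof (cases "{1..n} - set xs = {}")
  case True
  then show ?thesis unfolding complete_deck_def True by simp
next
  case False
  then have "hd (sorted_list_of_set ({1..n} - set xs)) = Min ({1..n} - set xs)"
    "sorted_list_of_set ({1..n} - set xs) \<noteq> []"
    by (simp_all only: sorted_list_of_set_nonempty finite_Diff finite_atLeastAtMost list.sel list.distinct simp_thms)
  then show ?thesis
    using False unfolding complete_deck_def by (subst list_descents_append_sorted) simp_all
qed

text \<open>The random set takes finitely many values, which reduces the claim to a fixed
  set.\<close>

lemma measurable_arrangement_pair:
  fixes S :: "'b \<Rightarrow> nat set"
  assumes "\<And>x. S x \<subseteq> {1..n}"
  shows "(\<lambda>\<omega>. arrangement (S (fst \<omega>)) (\<lambda>j. snd \<omega> (Suc j)))
    \<in> measurable (measure_pmf p \<Otimes>\<^sub>M uniform_vector n) (count_space UNIV)"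
proof (rule measurable_compose_countable'[where I = "Pow {1..n}" and g = "\<lambda>\<omega>. S (fst \<omega>)"])
  show "(\<lambda>\<omega>. arrangement T (\<lambda>j. snd \<omega> (Suc j))) \<in> measurable (measure_pmf p \<Otimes>\<^sub>M uniform_vector n) (count_space UNIV)"
    if "T \<in> Pow {1..n}" for T
    using that finite_subset[of T "{1..n}"] card_mono[of "{1..n}" T]
    by (intro measurable_compose[OF measurable_snd measurable_arrangement]) auto
  show "(\<lambda>\<omega>. S (fst \<omega>)) \<in> measurable (measure_pmf p \<Otimes>\<^sub>M uniform_vector n) (count_space (Pow {1..n}))"
    using assms by (intro measurable_compose[OF measurable_fst]) auto
qed (simp add: countable_finite)

text \<open>On the section at \<open>x\<close> the set \<open>S x\<close> is constant and its
  arrangement is uniform; integrating the sections over \<open>p\<close> gives the mixture on the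
  right.\<close>

lemma distr_arrangement_pair:
  fixes S :: "'b \<Rightarrow> nat set"
  assumes S: "\<And>x. S x \<subseteq> {1..n}"
  shows "distr (measure_pmf p \<Otimes>\<^sub>M uniform_vector n) (count_space UNIV)
      (\<lambda>\<omega>. arrangement (S (fst \<omega>)) (\<lambda>j. snd \<omega> (Suc j))) =
    measure_pmf (bind_pmf p (\<lambda>x. pmf_of_set (permutations_of_set (S x))))" (is "?D = ?R")
proof (rule measure_eqI)
  fix A
  interpret Q: prob_space "uniform_vector n" by (rule prob_space_uniform_vector)
  let ?M = "measure_pmf p \<Otimes>\<^sub>M uniform_vector n"
  let ?X = "\<lambda>\<omega>. arrangement (S (fst \<omega>)) (\<lambda>j. snd \<omega> (Suc j))"
  note meas = measurable_arrangement_pair[OF S, where p = p]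
  have fin: "finite (S x)" "card (S x) \<le> n" for x
    using S[of x] finite_subset[of "S x" "{1..n}"] card_mono[of "{1..n}" "S x"] by auto
  have "emeasure ?D A = emeasure ?M (?X -` A \<inter> space ?M)"
    by (rule emeasure_distr[OF meas]) simp
  also have "\<dots> = (\<integral>\<^sup>+x. emeasure (uniform_vector n) (Pair x -` (?X -` A \<inter> space ?M)) \<partial>measure_pmf p)"
    by (rule Q.emeasure_pair_measure_alt) (rule measurable_sets[OF meas], simp)
  also have "\<dots> = (\<integral>\<^sup>+x. emeasure (pmf_of_set (permutations_of_set (S x))) A \<partial>measure_pmf p)"
  proof (rule nn_integral_cong)
    fix x
    have "Pair x -` (?X -` A \<inter> space ?M) =
        (\<lambda>u. arrangement (S x) (\<lambda>j. u (Suc j))) -` A \<inter> space (uniform_vector n)"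
      by (auto simp: space_pair_measure)
    then show "emeasure (uniform_vector n) (Pair x -` (?X -` A \<inter> space ?M)) =
        emeasure (pmf_of_set (permutations_of_set (S x))) A"
      unfolding distr_arrangement[OF fin, symmetric]
      by (subst emeasure_distr[OF measurable_arrangement[OF fin]]) simp_all
  qed
  finally show "emeasure ?D A = emeasure ?R A" by simp
qed simp

lemma distr_descents_iterated_random_to_top:
  assumes "n \<ge> 1"
  shows "distr (iterated_random_to_top n r) borel (\<lambda>\<sigma>. real (descents n \<sigma>)) =
    distr (top_list n r) borel (\<lambda>xs. real (list_descents (complete_deck n xs)))"
proof -
  have "distr (iterated_random_to_top n r) borel (\<lambda>\<sigma>. real (descents n \<sigma>)) =
      distr (top_list n r) borel (\<lambda>xs. real (descents n (deck_of n (complete_deck n xs))))"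
    by (simp add: iterated_random_to_top_eq[OF assms] map_pmf_rep_eq distr_distr comp_def)
  also have "\<dots> = distr (top_list n r) borel (\<lambda>xs. real (list_descents (complete_deck n xs)))"
  \<comment> \<open>A completed list is known to have length \<open>n\<close> only on the support of
    \<open>top_list n r\<close>, hence the almost sure comparison.\<close>
  proof (rule distr_cong_AE)
    have "length (complete_deck n xs) = n" if "xs \<in> set_pmf (top_list n r)" for xs
      using length_finite_permutations_of_set[OF
          complete_deck_permutation[OF set_pmf_top_list[OF assms that]]] by simp
    then show "AE xs in top_list n r. real (descents n (deck_of n (complete_deck n xs))) =
        real (list_descents (complete_deck n xs))"
      by (auto simp: AE_measure_pmf_iff descents_deck_of)
  qed auto
  finally show ?thesis .
qed

theorem theorem4p2:
  fixes n r :: nat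
  assumes "n \<ge> 1" and "r \<ge> 1"
  shows "\<exists>(M :: ((nat \<Rightarrow> nat) \<times> (nat \<Rightarrow> real)) measure)
            (K :: (nat \<Rightarrow> nat) \<times> (nat \<Rightarrow> real) \<Rightarrow> nat)
            (U :: nat \<Rightarrow> (nat \<Rightarrow> nat) \<times> (nat \<Rightarrow> real) \<Rightarrow> real)
            (E :: (nat \<Rightarrow> nat) \<times> (nat \<Rightarrow> real) \<Rightarrow> real).
          prob_space M
        \<and> K \<in> measurable M (count_space UNIV)
        \<and> distr M (count_space UNIV) K = measure_pmf (occupied_boxes r n)
        \<and> (\<forall>i\<in>{1..n}. U i \<in> borel_measurable M
              \<and> distr M borel (U i) = uniform_measure lborel {0<..<1})
        \<and> prob_space.indep_vars M (\<lambda>_. borel) U {1..n}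
        \<and> prob_space.indep_set M
              (sets (vimage_algebra (space M) K (count_space UNIV)))
              (sets (vimage_algebra (space M) (\<lambda>\<omega>. \<lambda>i\<in>{1..n}. U i \<omega>) (\<Pi>\<^sub>M i\<in>{1..n}. borel)))
        \<and> E \<in> borel_measurable M
        \<and> (\<forall>\<omega>\<in>space M. \<bar>E \<omega>\<bar> \<le> 1)
        \<and> distr (measure_pmf (iterated_random_to_top n r)) borel (\<lambda>\<sigma>. real (descents n \<sigma>))
          = distr M borel
              (\<lambda>\<omega>. E \<omega> + (\<Sum>i = 1..K \<omega> - 1. if U i \<omega> > U (i + 1) \<omega> then 1 else 0))"
proof -
  \<comment> \<open>The probability space pairs ball placements with an independent uniform vector;
    the occupied boxes \<open>S f\<close> stand for the selected cards.\<close>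
  define B where "B = Pi_pmf {1..r} 0 (\<lambda>_. pmf_of_set {1..n})"
  define S where "S f = {b \<in> {1..n}. \<exists>j\<in>{1..r}. f j = b}" for f :: "nat \<Rightarrow> nat"
  define M where "M = measure_pmf B \<Otimes>\<^sub>M uniform_vector n"
  define K where "K \<omega> = card (S (fst \<omega>))" for \<omega> :: "(nat \<Rightarrow> nat) \<times> (nat \<Rightarrow> real)"
  define U where "U i \<omega> = snd \<omega> i" for i and \<omega> :: "(nat \<Rightarrow> nat) \<times> (nat \<Rightarrow> real)"
  define X where "X \<omega> = arrangement (S (fst \<omega>)) (\<lambda>j. snd \<omega> (Suc j))"
    for \<omega> :: "(nat \<Rightarrow> nat) \<times> (nat \<Rightarrow> real)"
  \<comment> \<open>\<open>J\<close> indicates a descent between the last selected card and the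
    least unselected one, so \<open>E\<close> takes only the values 0 and 1.\<close>
  define J :: "nat list \<Rightarrow> real" where
    "J xs = (if xs \<noteq> [] \<and> {1..n} - set xs \<noteq> {} \<and> last xs > Min ({1..n} - set xs) then 1 else 0)" for xs
  define E where "E \<omega> = J (X \<omega>)" for \<omega>
  interpret B: prob_space "measure_pmf B" by (rule prob_space_measure_pmf)
  interpret Q: prob_space "uniform_vector n" by (rule prob_space_uniform_vector)
  interpret P: pair_prob_space "measure_pmf B" "uniform_vector n" ..
  have prob: "prob_space M" unfolding M_def by (rule P.prob_space_axioms)
  have S: "S f \<subseteq> {1..n}" for f by (auto simp: S_def)
  have X_meas: "X \<in> measurable M (count_space UNIV)"
    unfolding X_def[abs_def] M_def by (rule measurable_arrangement_pair[OF S])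
  have fst: "distr M (measure_pmf B) fst = measure_pmf B"
    unfolding M_def by (rule Q.distr_pair_fst)
  have "distr M (count_space UNIV) K = distr (distr M (measure_pmf B) fst) (count_space UNIV) (\<lambda>f. card (S f))"
    by (subst distr_distr) (simp_all add: M_def K_def[abs_def] comp_def)
  also have "\<dots> = measure_pmf (occupied_boxes r n)"
    unfolding fst by (simp add: occupied_boxes_def map_pmf_rep_eq S_def[abs_def] B_def)
  finally have K_distr: "distr M (count_space UNIV) K = measure_pmf (occupied_boxes r n)" .
  have K_meas: "K \<in> measurable M (count_space UNIV)"
    unfolding K_def[abs_def] M_def by (rule measurable_compose[OF measurable_fst]) simp
  have indep: "prob_space.indep_set M (sets (vimage_algebra (space M) K (count_space UNIV)))
      (sets (vimage_algebra (space M) (\<lambda>\<omega>. \<lambda>i\<in>{1..n}. U i \<omega>) (\<Pi>\<^sub>M i\<in>{1..n}. borel)))"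
    unfolding M_def K_def[abs_def] U_def
    by (rule indep_set_fst_snd[OF prob_space_measure_pmf prob_space_uniform_vector _
          measurable_restrict[OF measurable_uniform_vector_component]]) simp
  \<comment> \<open>This holds at every outcome: entry \<open>i\<close> of \<open>X \<omega>\<close>
    is ranked by \<open>U (Suc i) \<omega>\<close>, so the descent indices of the list, moved up by
    one, are the indices counted in the sum.\<close>
  have sum: "E \<omega> + (\<Sum>i = 1..K \<omega> - 1. if U i \<omega> > U (i + 1) \<omega> then 1 else 0) =
      real (list_descents (complete_deck n (X \<omega>)))" for \<omega>
  proof -
    let ?I = "{i. Suc i < K \<omega> \<and> snd \<omega> (Suc i) > snd \<omega> (Suc (Suc i))}"
    have "(\<Sum>i = 1..K \<omega> - 1. if U i \<omega> > U (i + 1) \<omega> then 1 else 0) =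
        real (card {i \<in> {1..K \<omega> - 1}. U i \<omega> > U (i + 1) \<omega>})"
      by (simp add: sum.If_cases Int_def)
    also have "{i \<in> {1..K \<omega> - 1}. U i \<omega> > U (i + 1) \<omega>} = Suc ` ?I"
    proof (rule set_eqI)
      fix i show "i \<in> {i \<in> {1..K \<omega> - 1}. U i \<omega> > U (i + 1) \<omega>} \<longleftrightarrow> i \<in> Suc ` ?I"
        by (cases i) (auto simp: U_def)
    qed
    also have "card (Suc ` ?I) = list_descents (X \<omega>)"
      by (simp add: X_def list_descents_arrangement K_def card_image)
    finally show ?thesis by (simp add: list_descents_complete_deck E_def J_def)
  qed
  \<comment> \<open>Drawing the set as occupied boxes and then its order uniformly gives the law of
    the selected cards; ordering by the uniform variables realises it as \<open>X\<close>.\<close>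
  have "top_list n r = bind_pmf B (\<lambda>f. pmf_of_set (permutations_of_set (S f)))"
    by (subst top_list_conditionally_uniform[OF assms(1)])
      (simp add: map_set_top_list[OF assms(1)] bind_map_pmf B_def S_def)
  then have top: "distr M (count_space UNIV) X = measure_pmf (top_list n r)"
    unfolding M_def X_def[abs_def] by (simp only: distr_arrangement_pair[where S = S, OF S])
  let ?g = "\<lambda>xs. real (list_descents (complete_deck n xs))"
  have "distr (iterated_random_to_top n r) borel (\<lambda>\<sigma>. real (descents n \<sigma>)) =
      distr (distr M (count_space UNIV) X) borel ?g"
    unfolding top by (rule distr_descents_iterated_random_to_top[OF assms(1)])
  also have "\<dots> = distr M borel (?g \<circ> X)"
    by (rule distr_distr[OF _ X_meas]) simp
  also have "\<dots> = distr M borel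
      (\<lambda>\<omega>. E \<omega> + (\<Sum>i = 1..K \<omega> - 1. if U i \<omega> > U (i + 1) \<omega> then 1 else 0))"
    by (simp only: sum comp_def)
  finally have descents: "distr (iterated_random_to_top n r) borel (\<lambda>\<sigma>. real (descents n \<sigma>)) = \<dots>" .
  have E: "E \<in> borel_measurable M" "\<bar>E \<omega>\<bar> \<le> 1" for \<omega>
    unfolding E_def[abs_def] by (rule measurable_compose[OF X_meas], simp) (simp add: J_def)
  note coord = indep_vars_uniform_vector_coordinates[OF assms(1) prob_space_measure_pmf]
  have U_indep: "prob_space.indep_vars M (\<lambda>_. borel) U {1..n}"
    unfolding M_def U_def[abs_def] by (rule coord(1))
  have "\<forall>i\<in>{1..n}. U i \<in> borel_measurable M \<and> distr M borel (U i) = unit_uniform"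
    unfolding M_def U_def[abs_def] by (intro ballI conjI coord(2,3))
  moreover have "\<forall>\<omega>\<in>space M. \<bar>E \<omega>\<bar> \<le> 1"
    using E(2) by blast
  ultimately show ?thesis
    using prob K_meas K_distr U_indep indep E(1) descents
    by (intro exI[of _ M] exI[of _ K] exI[of _ U] exI[of _ E] conjI)
qed

end
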